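(* Let $p\in\{1,\dots,+\infty\}$, let $\boldsymbol\beta=(1,2,\dots,2)$ (that is, $\beta_0=1$ and $\beta_k=2$ for $1\le k\le p+1$), and let $\boldsymbol\delta=(\delta_k)_{k=0,\dots,p}$. Assume that $\delta_1\ne0$. Then $\boldsymbol\alpha=(\alpha_k)_{k=0,\dots,p}$ is $(\boldsymbol\beta,p)$-related to $\boldsymbol\delta$ (with associated rational functions $\hat\alpha_k$, where $\hat\alpha_0=0$ and $\alpha_k=\mathfrak e(\hat\alpha_k)$) if and only if $$\hat\alpha_1=\frac{-\hat\delta_0}{\hat\delta_1}\quad\text{and}\quad \hat\alpha_q=-\sum_{m=2}^q\frac{\hat\delta_m}{\hat\delta_1}\sum_{k_1+\dots+k_m=q}\hat\alpha_{k_1}\cdots\hat\alpha_{k_m}\quad\text{for }2\le q\le p .$$ In particular, there exists one and only one sequence $\boldsymbol\alpha$ which is $(\boldsymbol\beta,p)$-related to $\boldsymbol\delta$. Besides, each of the $\hat\alpha_q$ is a polynomial expression in $\hat\delta_m$, $m=0,\dots,q$, whose term in $\hat\delta_0$ has degree $q$.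
   Context: Definition ($(\boldsymbol\beta,p)$-related sequence). Given integers $\boldsymbol\beta=(\beta_k)_{k=0,\dots,p+1}$, put $\beta_\star:=\max_{2\le m\le p+1}\beta_m$ and $\gamma_m:=p+1+\min(\beta_m-\beta_\star,0)$ for $m=1,\dots,p$. Let $\hat\delta_0,\dots,\hat\delta_p$ be indeterminates ("dummy" versions of the numbers $\delta_k$), $\mathbb K:=\mathbb R(\hat\delta_0,\dots,\hat\delta_p)$ the rational functions in them, $z$ a further indeterminate, and $\mathfrak e$ the evaluation map sending $\hat\delta_k$ back to $\delta_k$, extended as an algebra homomorphism and by $\mathfrak e(P/Q)=\mathfrak e(P)/\mathfrak e(Q)$. A sequence $\boldsymbol\alpha=(\alpha_k)_{k=0,\dots,p}$ is $(\boldsymbol\beta,p)$-related to $\boldsymbol\delta$ if there exist rational functions $\hat\alpha_k\in\mathbb K$, $k=0,\dots,p$, with $\hat\alpha_0=0$, $\alpha_k=\mathfrak e(\hat\alpha_k)$, and $$\hat\delta_0z^{-\beta_0}+\sum_{m=1}^p\hat\delta_m\sum_{k_1+\dots+k_m<\gamma_m}\hat\alpha_{k_1}\cdots\hat\alpha_{k_m}z^{k_1+\dots+k_m-\beta_m}=0,$$ meaning that the coefficient in $\mathbb K$ of each power of $z$ vanishes. Sums run over multi-indices $(k_1,\dots,k_m)$ of nonnegative integers (indices $k_i=0$ contribute nothing since $\hat\alpha_0=0$).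
   Formalization: Since α̂_1 = −δ̂_0/δ̂_1 is not a polynomial, "polynomial expression in δ̂_m, m=0,…,q" is read as such a polynomial divided by a power of δ̂_1, with every monomial of degree exactly q in δ̂_0 (and nonzero for q ≥ 1). *)

theory Defs
  imports
    "HOL-Library.Poly_Mapping"
    "HOL-Library.Extended_Real"
    "HOL-Library.FuncSet"
    "HOL-Computational_Algebra.Fraction_Field"
begin

(* Real polynomials and rational functions in indeterminates indexed by nat. A monomial is a
   finitely supported exponent vector. Rational functions in the indeterminates 0..p, for
   p finite or infinite, form a subset of this one field. *)

type_synonym dpoly = "(nat \<Rightarrow>\<^sub>0 nat) \<Rightarrow>\<^sub>0 real"
type_synonym dratfun = "dpoly fract"

definition dvar :: "nat \<Rightarrow> dpoly" where
  "dvar k = Poly_Mapping.single (Poly_Mapping.single k 1) 1"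

definition \<delta>hat :: "nat \<Rightarrow> dratfun" where
  "\<delta>hat k = Fract (dvar k) 1"

definition dpolys_upto :: "enat \<Rightarrow> dpoly set" where
  "dpolys_upto p = {P. \<forall>t\<in>Poly_Mapping.keys P. \<forall>k\<in>Poly_Mapping.keys t. enat k \<le> p}"

definition dratfuns_upto :: "enat \<Rightarrow> dratfun set" where
  "dratfuns_upto p = {Fract P Q |P Q. P \<in> dpolys_upto p \<and> Q \<in> dpolys_upto p \<and> Q \<noteq> 0}"

definition eval_monom :: "(nat \<Rightarrow> real) \<Rightarrow> (nat \<Rightarrow>\<^sub>0 nat) \<Rightarrow> real" where
  "eval_monom \<delta> t = (\<Prod>k\<in>Poly_Mapping.keys t. \<delta> k ^ Poly_Mapping.lookup t k)"

definition eval_dpoly :: "(nat \<Rightarrow> real) \<Rightarrow> dpoly \<Rightarrow> real" where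
  "eval_dpoly \<delta> P = (\<Sum>t\<in>Poly_Mapping.keys P. Poly_Mapping.lookup P t * eval_monom \<delta> t)"

(* The evaluation map on rational functions is partial: "evaluates_to p \<delta> f a" says that f has
   a representation P/Q whose denominator does not vanish at \<delta>, and that the value is a. *)

definition evaluates_to :: "enat \<Rightarrow> (nat \<Rightarrow> real) \<Rightarrow> dratfun \<Rightarrow> real \<Rightarrow> bool" where
  "evaluates_to p \<delta> f a \<longleftrightarrow>
     (\<exists>P\<in>dpolys_upto p. \<exists>Q\<in>dpolys_upto p. f = Fract P Q \<and> eval_dpoly \<delta> Q \<noteq> 0 \<and>
        a = eval_dpoly \<delta> P / eval_dpoly \<delta> Q)"

(* Integer sets that are nonempty and bounded above contain their supremum, so SUP is the maximum. *)

definition \<beta>star :: "enat \<Rightarrow> (nat \<Rightarrow> int) \<Rightarrow> int" where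
  "\<beta>star p \<beta> = (SUP m\<in>{m. 2 \<le> m \<and> enat m \<le> p + 1}. \<beta> m)"

definition \<gamma>bound :: "enat \<Rightarrow> (nat \<Rightarrow> int) \<Rightarrow> nat \<Rightarrow> ereal" where
  "\<gamma>bound p \<beta> m = ereal_of_enat p + 1 + ereal (of_int (min (\<beta> m - \<beta>star p \<beta>) 0))"

(* The coefficient of z^n, n an integer, on the left-hand side of the defining equation. For
   p = \<infinity> the sum over m has finite support whenever \<alpha>hat 0 = 0 and \<beta> is bounded above. *)

definition relation_coeff ::
  "enat \<Rightarrow> (nat \<Rightarrow> int) \<Rightarrow> (nat \<Rightarrow> dratfun) \<Rightarrow> int \<Rightarrow> dratfun" where
  "relation_coeff p \<beta> \<alpha>hat n =
     (\<delta>hat 0 when n = - \<beta> 0) +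
     Sum_any (\<lambda>m.
       (\<delta>hat m * (\<Sum>ks | length ks = m \<and> ereal (real (sum_list ks)) < \<gamma>bound p \<beta> m \<and>
                         int (sum_list ks) - \<beta> m = n. prod_list (map \<alpha>hat ks)))
       when (1 \<le> m \<and> enat m \<le> p))"

definition lifts :: "enat \<Rightarrow> (nat \<Rightarrow> real) \<Rightarrow> (nat \<Rightarrow> real) \<Rightarrow> (nat \<Rightarrow> dratfun) \<Rightarrow> bool" where
  "lifts p \<delta> \<alpha> \<alpha>hat \<longleftrightarrow>
     (\<forall>k. enat k \<le> p \<longrightarrow> \<alpha>hat k \<in> dratfuns_upto p \<and> evaluates_to p \<delta> (\<alpha>hat k) (\<alpha> k)) \<and>
     \<alpha>hat 0 = 0"

definition related_with ::
  "(nat \<Rightarrow> int) \<Rightarrow> enat \<Rightarrow> (nat \<Rightarrow> real) \<Rightarrow> (nat \<Rightarrow> real) \<Rightarrow> (nat \<Rightarrow> dratfun) \<Rightarrow> bool" where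
  "related_with \<beta> p \<delta> \<alpha> \<alpha>hat \<longleftrightarrow>
     lifts p \<delta> \<alpha> \<alpha>hat \<and> (\<forall>n. relation_coeff p \<beta> \<alpha>hat n = 0)"

definition related ::
  "(nat \<Rightarrow> int) \<Rightarrow> enat \<Rightarrow> (nat \<Rightarrow> real) \<Rightarrow> (nat \<Rightarrow> real) \<Rightarrow> bool" where
  "related \<beta> p \<delta> \<alpha> \<longleftrightarrow> (\<exists>\<alpha>hat. related_with \<beta> p \<delta> \<alpha> \<alpha>hat)"


(* eval_dpoly is the algebra homomorphism sending dvar k to \<delta> k. *)

lemma eval_monom_superset:
  assumes "finite A" "Poly_Mapping.keys t \<subseteq> A"
  shows "eval_monom \<delta> t = (\<Prod>k\<in>A. \<delta> k ^ Poly_Mapping.lookup t k)"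
  unfolding eval_monom_def
  by (rule prod.mono_neutral_left) (use assms in \<open>auto simp: in_keys_iff\<close>)

lemma eval_monom_add: "eval_monom \<delta> (s + t) = eval_monom \<delta> s * eval_monom \<delta> t"
proof -
  let ?A = "Poly_Mapping.keys s \<union> Poly_Mapping.keys t"
  have "eval_monom \<delta> (s + t) = (\<Prod>k\<in>?A. \<delta> k ^ Poly_Mapping.lookup (s + t) k)"
    by (rule eval_monom_superset) (use Poly_Mapping.keys_add[of s t] in auto)
  also have "\<dots> = eval_monom \<delta> s * eval_monom \<delta> t"
    by (simp add: eval_monom_superset[of ?A] lookup_add power_add prod.distrib)
  finally show ?thesis .
qed

lemma eval_dpoly_superset:
  assumes "finite A" "Poly_Mapping.keys P \<subseteq> A"
  shows "eval_dpoly \<delta> P = (\<Sum>t\<in>A. Poly_Mapping.lookup P t * eval_monom \<delta> t)"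
  unfolding eval_dpoly_def
  by (rule sum.mono_neutral_left) (use assms in \<open>auto simp: in_keys_iff\<close>)

lemma eval_dpoly_add: "eval_dpoly \<delta> (P + Q) = eval_dpoly \<delta> P + eval_dpoly \<delta> Q"
proof -
  let ?A = "Poly_Mapping.keys P \<union> Poly_Mapping.keys Q"
  have "eval_dpoly \<delta> (P + Q) = (\<Sum>t\<in>?A. Poly_Mapping.lookup (P + Q) t * eval_monom \<delta> t)"
    by (rule eval_dpoly_superset) (use Poly_Mapping.keys_add[of P Q] in auto)
  also have "\<dots> = eval_dpoly \<delta> P + eval_dpoly \<delta> Q"
    by (simp add: eval_dpoly_superset[of ?A] lookup_add distrib_right sum.distrib)
  finally show ?thesis .
qed

lemma eval_dpoly_single: "eval_dpoly \<delta> (Poly_Mapping.single t c) = c * eval_monom \<delta> t"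
  by (simp add: eval_dpoly_def)

lemma eval_dpoly_const: "eval_dpoly \<delta> (Poly_Mapping.single 0 c) = c"
  by (simp add: eval_dpoly_single eval_monom_def)

lemma eval_dpoly_dvar: "eval_dpoly \<delta> (dvar k) = \<delta> k"
  by (simp add: dvar_def eval_dpoly_single eval_monom_def)

lemma eval_dpoly_0: "eval_dpoly \<delta> 0 = 0"
  by (simp add: eval_dpoly_def)

lemma eval_dpoly_sum: "eval_dpoly \<delta> (sum f A) = (\<Sum>x\<in>A. eval_dpoly \<delta> (f x))"
  by (induction A rule: infinite_finite_induct) (simp_all add: eval_dpoly_0 eval_dpoly_add)

lemma dpoly_expand:
  fixes P :: dpoly
  shows "P = (\<Sum>t\<in>Poly_Mapping.keys P. Poly_Mapping.single t (Poly_Mapping.lookup P t))"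
  by (rule poly_mapping_eqI) (auto simp: lookup_sum lookup_single when_def in_keys_iff)

lemma eval_dpoly_mult: "eval_dpoly \<delta> (P * Q) = eval_dpoly \<delta> P * eval_dpoly \<delta> Q"
proof -
  have "P * Q = (\<Sum>s\<in>Poly_Mapping.keys P. \<Sum>t\<in>Poly_Mapping.keys Q.
      Poly_Mapping.single s (Poly_Mapping.lookup P s) *
      Poly_Mapping.single t (Poly_Mapping.lookup Q t))"
    by (subst dpoly_expand[of P], subst dpoly_expand[of Q]) (simp add: sum_product)
  then show ?thesis
    by (simp add: eval_dpoly_sum mult_single eval_dpoly_single eval_monom_add
        eval_dpoly_def[of \<delta> P] eval_dpoly_def[of \<delta> Q] sum_product mult_ac)
qed

lemma evaluates_to_unique:
  assumes "evaluates_to p \<delta> f a" "evaluates_to p' \<delta> f b"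
  shows "a = b"
proof -
  from assms obtain P Q R S where
    *: "f = Fract P Q" "eval_dpoly \<delta> Q \<noteq> 0" "a = eval_dpoly \<delta> P / eval_dpoly \<delta> Q"
       "f = Fract R S" "eval_dpoly \<delta> S \<noteq> 0" "b = eval_dpoly \<delta> R / eval_dpoly \<delta> S"
    unfolding evaluates_to_def by blast
  then have "Q \<noteq> 0" "S \<noteq> 0" by (auto simp: eval_dpoly_0)
  with * have "P * S = R * Q" by (simp add: eq_fract)
  then have "eval_dpoly \<delta> P * eval_dpoly \<delta> S = eval_dpoly \<delta> R * eval_dpoly \<delta> Q"
    by (metis eval_dpoly_mult)
  then show ?thesis unfolding *(3) *(6) using *(2) *(5) by (simp add: frac_eq_eq)
qed

end

theory Submission
  imports Defs
begin

text \<open>Since \<open>\<alpha>hat 0 = 0\<close>, only lists of positive indices contribute to the defining equation, so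
  the coefficient of \<open>z\<^sup>q\<^sup>-\<^sup>2\<close> determines \<open>\<alpha>hat q\<close> in terms of the earlier terms, after division
  by \<open>\<delta>hat 1\<close>. Following the recursion, every \<open>\<alpha>hat q\<close> is a polynomial homogeneous of degree \<open>q\<close>
  in \<open>\<delta>hat 0\<close> over a power of \<open>\<delta>hat 1\<close>. This polynomial is nonzero because at \<open>\<delta> 1 = 1\<close> and
  \<open>\<delta> m = -1\<close> for all other \<open>m\<close> the recursion only produces positive numbers.\<close>

section \<open>Compositions\<close>

text \<open>Excluding zero entries bounds the number of parts by \<open>q\<close> and, for at least
  two parts, every entry by \<open>q - 1\<close>. The first makes the sum over \<open>m\<close>
  finite, the second makes the recursion well-founded.\<close>

definition compositions :: "nat \<Rightarrow> nat \<Rightarrow> nat list set" where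
  "compositions m q = {ks. length ks = m \<and> sum_list ks = q \<and> 0 \<notin> set ks}"

lemma finite_lists_length_sum:
  "finite {ks :: nat list. length ks = m \<and> sum_list ks = q}"
proof (rule finite_subset)
  show "{ks :: nat list. length ks = m \<and> sum_list ks = q} \<subseteq> {ks. set ks \<subseteq> {..q} \<and> length ks = m}"
    by (auto dest: member_le_sum_list)
qed (rule finite_lists_length_eq, simp)

lemma finite_compositions: "finite (compositions m q)"
  by (rule finite_subset[OF _ finite_lists_length_sum[of m q]]) (auto simp: compositions_def)

text \<open>A list containing 0 has the factor \<open>a 0 = 0\<close> in its product, so it drops
  out.\<close>

lemma sum_lists_eq_sum_compositions:
  fixes a :: "nat \<Rightarrow> 'a :: comm_semiring_1"
  assumes "a 0 = 0"
  shows "(\<Sum>ks | length ks = m \<and> sum_list ks = q. prod_list (map a ks)) =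
         (\<Sum>ks\<in>compositions m q. prod_list (map a ks))"
proof (rule sum.mono_neutral_right)
  have "prod_list (map a ks) = 0" if "0 \<in> set ks" for ks
    using that assms by (induction ks) auto
  then show "\<forall>ks\<in>{ks. length ks = m \<and> sum_list ks = q} - compositions m q. prod_list (map a ks) = 0"
    by (auto simp: compositions_def)
qed (auto simp: finite_lists_length_sum compositions_def)

lemma length_le_sum_list:
  fixes ks :: "nat list"
  assumes "0 \<notin> set ks"
  shows "length ks \<le> sum_list ks"
  using assms by (induction ks) auto

lemma compositions_eq_empty: "q < m \<Longrightarrow> compositions m q = {}"
  using length_le_sum_list by (force simp: compositions_def)

text \<open>Besides \<open>k\<close> there is at least one other entry, and it contributes at least
  1 to the sum.\<close>

lemma compositions_less:
  assumes "ks \<in> compositions m q" "2 \<le> m" "k \<in> set ks"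
  shows "k < q"
proof -
  obtain xs ys where ks: "ks = xs @ k # ys"
    using assms(3) by (auto simp: in_set_conv_decomp)
  have "length xs + length ys \<le> sum_list xs + sum_list ys"
    by (intro add_mono length_le_sum_list) (use assms(1) ks in \<open>auto simp: compositions_def\<close>)
  with assms ks show ?thesis
    by (auto simp: compositions_def)
qed

section \<open>The recursion\<close>

text \<open>Field and coefficients are left general because three instances are compared: the formal
  one with \<open>\<delta>hat\<close>, the real one with \<open>\<delta>\<close>, and a real one
  with special signs that detects nonzero polynomials.\<close>

definition solves_recursion :: "enat \<Rightarrow> (nat \<Rightarrow> 'a) \<Rightarrow> (nat \<Rightarrow> 'a :: field) \<Rightarrow> bool" where
  "solves_recursion p d a \<longleftrightarrow> a 0 = 0 \<and> a 1 = - d 0 / d 1 \<and>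
     (\<forall>q. 2 \<le> q \<and> enat q \<le> p \<longrightarrow>
        a q = - (\<Sum>m=2..q. d m / d 1 * (\<Sum>ks\<in>compositions m q. prod_list (map a ks))))"

lemma solves_recursionD:
  assumes "solves_recursion p d a"
  shows "a 0 = 0" "a 1 = - d 0 / d 1"
    "2 \<le> q \<Longrightarrow> enat q \<le> p \<Longrightarrow>
       a q = - (\<Sum>m=2..q. d m / d 1 * (\<Sum>ks\<in>compositions m q. prod_list (map a ks)))"
  using assms by (auto simp: solves_recursion_def)

lemma recursion_step_cong:
  assumes "\<And>k. k < q \<Longrightarrow> a k = b k"
  shows "(\<Sum>m=2..q. c m * (\<Sum>ks\<in>compositions m q. prod_list (map a ks))) =
         (\<Sum>m=2..q. c m * (\<Sum>ks\<in>compositions m q. prod_list (map b ks)))"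
proof -
  have "map a ks = map b ks" if "ks \<in> compositions m q" "m \<in> {2..q}" for ks m
    using that compositions_less assms by auto
  then have "(\<Sum>ks\<in>compositions m q. prod_list (map a ks)) =
      (\<Sum>ks\<in>compositions m q. prod_list (map b ks))" if "m \<in> {2..q}" for m
    using that by (intro sum.cong refl arg_cong[where f = prod_list]) blast
  then show ?thesis
    by (intro sum.cong) auto
qed

lemma recursion_exists: "\<exists>a. solves_recursion p d a"
proof -
  define F where "F a q = (\<Sum>m=2..q. d m / d 1 * (\<Sum>ks\<in>compositions m q. prod_list (map a ks)))" for a q
  \<comment> \<open>Stating the recursion as a relation between the sequence and its value at
    \<open>q\<close> fits choice along a well-order. It is imposed at all \<open>q\<close>, so the
    result serves every \<open>p\<close>.\<close>
  define P where "P a q r \<longleftrightarrow> r = (if q = 0 then 0 else if q = 1 then - d 0 / d 1 else - F a q)" for a q r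
  have "\<exists>a. \<forall>q. P a q (a q)"
  proof (rule dependent_wellorder_choice)
    show "P a q r = P b q r" if "\<And>k. k < q \<Longrightarrow> a k = b k" for r a b q
    proof -
      have "F a q = F b q"
        unfolding F_def by (rule recursion_step_cong) (rule that)
      then show ?thesis
        by (simp only: P_def)
    qed
  qed (simp add: P_def)
  then obtain a where "\<forall>q. P a q (a q)" ..
  then have "solves_recursion p d a"
    unfolding P_def F_def solves_recursion_def by simp
  then show ?thesis by blast
qed

lemma recursion_unique:
  assumes "solves_recursion p d a" "solves_recursion p d b" "enat q \<le> p"
  shows "a q = b q"
  using assms(3)
proof (induction q rule: less_induct)
  case (less q)
  consider "q = 0" | "q = 1" | "2 \<le> q" by linarith
  then show ?case
  proof cases
    case 3
    have "a k = b k" if "k < q" for k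
      using less that by (meson enat_ord_simps(1) less_imp_le order_trans)
    then show ?thesis
      unfolding solves_recursionD(3)[OF assms(1) 3 less.prems]
        solves_recursionD(3)[OF assms(2) 3 less.prems]
      by (intro arg_cong[where f = uminus] recursion_step_cong)
  qed (use solves_recursionD[OF assms(1)] solves_recursionD[OF assms(2)] in auto)
qed

text \<open>For these coefficients \<open>- d m / d 1\<close> is 1 whenever \<open>m\<close> differs
  from 1, so the recursion starts at 1 and only adds products of earlier, positive values.\<close>

lemma recursion_pos:
  fixes a :: "nat \<Rightarrow> real"
  assumes "solves_recursion p (\<lambda>m. if m = 1 then 1 else - 1) a" "1 \<le> q" "enat q \<le> p"
  shows "0 < a q"
  using assms(2,3)
proof (induction q rule: less_induct)
  case (less q)
  show ?case
  proof (cases "q = 1")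
    case True
    then show ?thesis using solves_recursionD(2)[OF assms(1)] by simp
  next
    case False
    then have q: "2 \<le> q" using less.prems by simp
    have pos: "0 < prod_list (map a ks)" if "ks \<in> compositions m q" "2 \<le> m" for ks m
    proof -
      have "0 < a k" if "k \<in> set ks" for k
      proof (rule less.IH)
        show "k < q" using compositions_less \<open>ks \<in> _\<close> \<open>2 \<le> m\<close> that .
        then show "enat k \<le> p"
          using less.prems(2) by (meson enat_ord_simps(1) less_imp_le order_trans)
        show "1 \<le> k"
          using \<open>ks \<in> _\<close> that by (cases k) (auto simp: compositions_def)
      qed
      then show ?thesis by (induction ks) auto
    qed
    \<comment> \<open>The all-ones list shows that the summand \<open>m = q\<close> is a nonempty
      sum, hence strictly positive; nonnegativity of the other summands then suffices.\<close>
    have "replicate q 1 \<in> compositions q q"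
      by (simp add: compositions_def sum_list_replicate)
    then have "0 < (\<Sum>ks\<in>compositions q q. prod_list (map a ks))"
      using pos q by (intro sum_pos) (auto simp: finite_compositions)
    moreover have "0 \<le> (\<Sum>ks\<in>compositions m q. prod_list (map a ks))" if "2 \<le> m" for m
      using pos that by (intro sum_nonneg) (auto intro: less_imp_le)
    ultimately have "0 < (\<Sum>m=2..q. \<Sum>ks\<in>compositions m q. prod_list (map a ks))"
      using q by (intro sum_pos2[where i = q]) auto
    also have "\<dots> = a q"
      unfolding solves_recursionD(3)[OF assms(1) q less.prems(2)] sum_negf[symmetric]
      by (rule sum.cong) auto
    finally show ?thesis .
  qed
qed

section \<open>Shape and evaluation of the solution\<close>

lemma dpolys_upto_mono: "p \<le> p' \<Longrightarrow> dpolys_upto p \<subseteq> dpolys_upto p'"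
  by (auto simp: dpolys_upto_def intro: order_trans)

lemma dpolys_upto_0: "0 \<in> dpolys_upto p"
  by (simp add: dpolys_upto_def)

lemma dpolys_upto_1: "1 \<in> dpolys_upto p"
  by (simp add: dpolys_upto_def)

lemma dpolys_upto_dvar: "enat k \<le> p \<Longrightarrow> dvar k \<in> dpolys_upto p"
  by (simp add: dpolys_upto_def dvar_def)

lemma dpolys_upto_uminus: "P \<in> dpolys_upto p \<Longrightarrow> - P \<in> dpolys_upto p"
  by (simp add: dpolys_upto_def)

lemma dpolys_upto_add: "P \<in> dpolys_upto p \<Longrightarrow> Q \<in> dpolys_upto p \<Longrightarrow> P + Q \<in> dpolys_upto p"
  using Poly_Mapping.keys_add[of P Q] by (auto simp: dpolys_upto_def)

lemma dpolys_upto_mult: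
  assumes "P \<in> dpolys_upto p" "Q \<in> dpolys_upto p"
  shows "P * Q \<in> dpolys_upto p"
  unfolding dpolys_upto_def
proof (intro CollectI ballI)
  fix t k assume "t \<in> Poly_Mapping.keys (P * Q)" "k \<in> Poly_Mapping.keys t"
  then obtain s u where "s \<in> Poly_Mapping.keys P" "u \<in> Poly_Mapping.keys Q" "t = s + u"
    using keys_mult[of P Q] by blast
  then show "enat k \<le> p"
    using assms \<open>k \<in> _\<close> Poly_Mapping.keys_add[of s u] by (auto simp: dpolys_upto_def)
qed

lemma dpolys_upto_power: "P \<in> dpolys_upto p \<Longrightarrow> P ^ n \<in> dpolys_upto p"
  by (induction n) (simp_all add: dpolys_upto_1 dpolys_upto_mult)

lemma eval_dpoly_1: "eval_dpoly \<delta> 1 = 1"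
  using eval_dpoly_const[of \<delta> 1] by simp

lemma eval_dpoly_power: "eval_dpoly \<delta> (P ^ n) = eval_dpoly \<delta> P ^ n"
  by (induction n) (simp_all add: eval_dpoly_1 eval_dpoly_mult)

lemma eval_dpoly_uminus: "eval_dpoly \<delta> (- P) = - eval_dpoly \<delta> P"
  using eval_dpoly_add[of \<delta> P "- P"] by (simp add: eval_dpoly_0)

lemma dvar_nonzero: "dvar k \<noteq> 0"
  using eval_dpoly_dvar[of "\<lambda>_. 1" k] by (auto simp: eval_dpoly_0)

lemma \<delta>hat_nonzero: "\<delta>hat k \<noteq> 0"
  by (simp add: \<delta>hat_def dvar_nonzero Zero_fract_def eq_fract)

lemma \<delta>hat_power: "\<delta>hat k ^ n = Fract (dvar k ^ n) 1"
  by (induction n) (simp_all add: One_fract_def \<delta>hat_def)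

text \<open>This is homogeneity in the indeterminate 0 alone. The zero polynomial satisfies it for
  every \<open>s\<close>, so nonvanishing has to be proved separately.\<close>

definition homogeneous0 :: "nat \<Rightarrow> dpoly \<Rightarrow> bool" where
  "homogeneous0 s P \<longleftrightarrow> (\<forall>t\<in>Poly_Mapping.keys P. Poly_Mapping.lookup t 0 = s)"

lemma homogeneous0_0: "homogeneous0 s 0"
  by (simp add: homogeneous0_def)

lemma homogeneous0_1: "homogeneous0 0 1"
  by (simp add: homogeneous0_def)

lemma homogeneous0_dvar: "homogeneous0 (if k = 0 then 1 else 0) (dvar k)"
  by (simp add: homogeneous0_def dvar_def lookup_single)

lemma homogeneous0_uminus: "homogeneous0 s P \<Longrightarrow> homogeneous0 s (- P)"
  by (simp add: homogeneous0_def)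

lemma homogeneous0_add: "homogeneous0 s P \<Longrightarrow> homogeneous0 s Q \<Longrightarrow> homogeneous0 s (P + Q)"
  using Poly_Mapping.keys_add[of P Q] by (auto simp: homogeneous0_def)

lemma homogeneous0_mult:
  assumes "homogeneous0 s P" "homogeneous0 s' Q"
  shows "homogeneous0 (s + s') (P * Q)"
  unfolding homogeneous0_def
proof
  fix t assume "t \<in> Poly_Mapping.keys (P * Q)"
  then obtain u v where "u \<in> Poly_Mapping.keys P" "v \<in> Poly_Mapping.keys Q" "t = u + v"
    using keys_mult[of P Q] by blast
  then show "Poly_Mapping.lookup t 0 = s + s'"
    using assms by (simp add: homogeneous0_def lookup_add)
qed

lemma homogeneous0_dvar1_power: "homogeneous0 0 (dvar 1 ^ n)"
proof (induction n)
  case (Suc n)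
  then show ?case
    using homogeneous0_mult[OF homogeneous0_dvar[of 1] Suc] by simp
qed (simp add: homogeneous0_1)

text \<open>Pairs a formal quotient with its value at \<open>\<delta>\<close>, using the same
  \<open>P\<close> and \<open>n\<close> for both. One induction then yields the variables (up to
  \<open>r\<close>), the degree in \<open>\<delta>hat 0\<close> (\<open>s\<close>) and the
  evaluation (\<open>v\<close>) together.\<close>

definition homogeneous_value ::
  "(nat \<Rightarrow> real) \<Rightarrow> nat \<Rightarrow> nat \<Rightarrow> dratfun \<Rightarrow> real \<Rightarrow> bool" where
  "homogeneous_value \<delta> r s f v \<longleftrightarrow> (\<exists>P n. P \<in> dpolys_upto (enat r) \<and> homogeneous0 s P \<and>
     f = Fract P 1 / \<delta>hat 1 ^ n \<and> v = eval_dpoly \<delta> P / \<delta> 1 ^ n)"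

lemma homogeneous_valueI:
  assumes "P \<in> dpolys_upto (enat r)" "homogeneous0 s P"
    "f = Fract P 1 / \<delta>hat 1 ^ n" "v = eval_dpoly \<delta> P / \<delta> 1 ^ n"
  shows "homogeneous_value \<delta> r s f v"
  using assms unfolding homogeneous_value_def by blast

lemma homogeneous_valueE:
  assumes "homogeneous_value \<delta> r s f v"
  obtains P n where "P \<in> dpolys_upto (enat r)" "homogeneous0 s P"
    "f = Fract P 1 / \<delta>hat 1 ^ n" "v = eval_dpoly \<delta> P / \<delta> 1 ^ n"
  using assms unfolding homogeneous_value_def by blast

lemma homogeneous_value_0: "homogeneous_value \<delta> r s 0 0"
  by (rule homogeneous_valueI[of 0 _ _ _ 0])
    (simp_all add: dpolys_upto_0 homogeneous0_0 Zero_fract_def eval_dpoly_0)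

lemma homogeneous_value_1: "homogeneous_value \<delta> r 0 1 1"
  by (rule homogeneous_valueI[of 1 _ _ _ 0])
    (simp_all add: dpolys_upto_1 homogeneous0_1 One_fract_def eval_dpoly_1)

lemma homogeneous_value_mono:
  "homogeneous_value \<delta> r s f v \<Longrightarrow> r \<le> r' \<Longrightarrow> homogeneous_value \<delta> r' s f v"
  unfolding homogeneous_value_def
  using dpolys_upto_mono[of "enat r" "enat r'"] by auto

lemma homogeneous_value_ratio:
  assumes "k \<le> r"
  shows "homogeneous_value \<delta> r (if k = 0 then 1 else 0) (\<delta>hat k / \<delta>hat 1) (\<delta> k / \<delta> 1)"
proof (rule homogeneous_valueI)
  show "\<delta>hat k / \<delta>hat 1 = Fract (dvar k) 1 / \<delta>hat 1 ^ 1"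
    by (simp only: \<delta>hat_def power_one_right)
qed (use assms in \<open>simp_all only: dpolys_upto_dvar homogeneous0_dvar eval_dpoly_dvar
      power_one_right enat_ord_simps\<close>)

lemma homogeneous_value_uminus:
  assumes "homogeneous_value \<delta> r s f v"
  shows "homogeneous_value \<delta> r s (- f) (- v)"
proof -
  from assms obtain P n where P: "P \<in> dpolys_upto (enat r)" "homogeneous0 s P"
    "f = Fract P 1 / \<delta>hat 1 ^ n" "v = eval_dpoly \<delta> P / \<delta> 1 ^ n"
    by (rule homogeneous_valueE)
  have "- f = Fract (- P) 1 / \<delta>hat 1 ^ n"
    unfolding P(3) by (metis minus_divide_left minus_fract)
  then show ?thesis
    by (rule homogeneous_valueI[rotated 2])
      (use P in \<open>simp_all add: dpolys_upto_uminus homogeneous0_uminus eval_dpoly_uminus\<close>)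
qed

lemma homogeneous_value_mult:
  assumes "homogeneous_value \<delta> r s f v" "homogeneous_value \<delta> r s' g w"
  shows "homogeneous_value \<delta> r (s + s') (f * g) (v * w)"
proof -
  from assms(1) obtain P n where P: "P \<in> dpolys_upto (enat r)" "homogeneous0 s P"
    "f = Fract P 1 / \<delta>hat 1 ^ n" "v = eval_dpoly \<delta> P / \<delta> 1 ^ n"
    by (rule homogeneous_valueE)
  from assms(2) obtain Q m where Q: "Q \<in> dpolys_upto (enat r)" "homogeneous0 s' Q"
    "g = Fract Q 1 / \<delta>hat 1 ^ m" "w = eval_dpoly \<delta> Q / \<delta> 1 ^ m"
    by (rule homogeneous_valueE)
  have "f * g = (Fract P 1 * Fract Q 1) / \<delta>hat 1 ^ (n + m)"
    unfolding P(3) Q(3) by (simp only: times_divide_times_eq power_add)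
  then have "f * g = Fract (P * Q) 1 / \<delta>hat 1 ^ (n + m)"
    by (simp only: mult_fract mult_1)
  then show ?thesis
    by (rule homogeneous_valueI[rotated 2])
      (use P Q in \<open>simp_all add: dpolys_upto_mult homogeneous0_mult eval_dpoly_mult power_add\<close>)
qed

lemma homogeneous_value_add:
  assumes "homogeneous_value \<delta> r s f v" "homogeneous_value \<delta> r s g w" "1 \<le> r" "\<delta> 1 \<noteq> 0"
  shows "homogeneous_value \<delta> r s (f + g) (v + w)"
proof -
  from assms(1) obtain P n where P: "P \<in> dpolys_upto (enat r)" "homogeneous0 s P"
    "f = Fract P 1 / \<delta>hat 1 ^ n" "v = eval_dpoly \<delta> P / \<delta> 1 ^ n"
    by (rule homogeneous_valueE)
  from assms(2) obtain Q m where Q: "Q \<in> dpolys_upto (enat r)" "homogeneous0 s Q"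
    "g = Fract Q 1 / \<delta>hat 1 ^ m" "w = eval_dpoly \<delta> Q / \<delta> 1 ^ m"
    by (rule homogeneous_valueE)
  define R where "R = P * dvar 1 ^ m + Q * dvar 1 ^ n"
  have R_frac: "Fract R 1 = Fract P 1 * \<delta>hat 1 ^ m + Fract Q 1 * \<delta>hat 1 ^ n"
    unfolding R_def \<delta>hat_power by simp
  have "f + g = (Fract P 1 * \<delta>hat 1 ^ m + Fract Q 1 * \<delta>hat 1 ^ n) / (\<delta>hat 1 ^ n * \<delta>hat 1 ^ m)"
    unfolding P(3) Q(3) by (rule add_frac_eq) (simp_all only: power_not_zero \<delta>hat_nonzero not_False_eq_True)
  then have fg: "f + g = Fract R 1 / \<delta>hat 1 ^ (n + m)"
    by (simp only: R_frac power_add)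
  have "dvar 1 \<in> dpolys_upto (enat r)"
    using \<open>1 \<le> r\<close> by (intro dpolys_upto_dvar) simp
  then have "R \<in> dpolys_upto (enat r)"
    unfolding R_def using P(1) Q(1) by (intro dpolys_upto_add dpolys_upto_mult dpolys_upto_power)
  moreover have "homogeneous0 s R"
    unfolding R_def
    using homogeneous0_mult[OF P(2) homogeneous0_dvar1_power[of m]]
      homogeneous0_mult[OF Q(2) homogeneous0_dvar1_power[of n]] by (simp add: homogeneous0_add)
  moreover have "v + w = eval_dpoly \<delta> R / \<delta> 1 ^ (n + m)"
    unfolding P(4) Q(4) R_def using \<open>\<delta> 1 \<noteq> 0\<close>
    by (simp add: eval_dpoly_add eval_dpoly_mult eval_dpoly_power eval_dpoly_dvar power_add add_frac_eq)
  ultimately show ?thesis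
    using fg by (intro homogeneous_valueI)
qed

lemma homogeneous_value_sum:
  assumes "\<And>x. x \<in> A \<Longrightarrow> homogeneous_value \<delta> r s (f x) (v x)" "1 \<le> r" "\<delta> 1 \<noteq> 0"
  shows "homogeneous_value \<delta> r s (sum f A) (sum v A)"
  using assms(1)
proof (induction A rule: infinite_finite_induct)
  case (insert x A)
  then have "homogeneous_value \<delta> r s (f x + sum f A) (v x + sum v A)"
    by (intro homogeneous_value_add assms(2,3)) simp_all
  with insert.hyps show ?case by simp
qed (simp_all add: homogeneous_value_0)

text \<open>If the factor of index \<open>k\<close> has degree \<open>k\<close>, the degrees add up
  to \<open>sum_list ks\<close>, which is \<open>q\<close> on every composition of \<open>q\<close>.
  This is the source of the degree \<open>q\<close> in the theorem.\<close>

lemma homogeneous_value_prod_list: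
  assumes "\<And>k. k \<in> set ks \<Longrightarrow> homogeneous_value \<delta> r k (f k) (v k)"
  shows "homogeneous_value \<delta> r (sum_list ks) (prod_list (map f ks)) (prod_list (map v ks))"
  using assms by (induction ks) (simp_all add: homogeneous_value_1 homogeneous_value_mult)

text \<open>The formal and the real recursion have the same form, so both are followed step by step
  in parallel.\<close>

lemma recursion_homogeneous_value:
  assumes f: "solves_recursion p \<delta>hat f" and v: "solves_recursion p \<delta> v"
    and "\<delta> 1 \<noteq> 0" "enat q \<le> p"
  shows "homogeneous_value \<delta> q q (f q) (v q)"
  using assms(4)
proof (induction q rule: less_induct)
  case (less q)
  consider "q = 0" | "q = 1" | "2 \<le> q" by linarith
  then show ?case
  proof cases
    case 1
    then show ?thesis
      using solves_recursionD(1)[OF f] solves_recursionD(1)[OF v] by (simp add: homogeneous_value_0)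
  next
    case 2
    have "homogeneous_value \<delta> 1 1 (\<delta>hat 0 / \<delta>hat 1) (\<delta> 0 / \<delta> 1)"
      using homogeneous_value_ratio[of 0 1 \<delta>] by (simp only: le0 simp_thms if_True)
    from homogeneous_value_uminus[OF this] show ?thesis
      unfolding 2 solves_recursionD(2)[OF f] solves_recursionD(2)[OF v]
      by (simp only: minus_divide_left)
  next
    case 3
    have "homogeneous_value \<delta> q k (f k) (v k)" if "k < q" for k
    proof (rule homogeneous_value_mono)
      show "homogeneous_value \<delta> k k (f k) (v k)"
        using less that by (meson enat_ord_simps(1) less_imp_le order_trans)
    qed (use that in simp)
    then have prod: "homogeneous_value \<delta> q q (prod_list (map f ks)) (prod_list (map v ks))"
      if "ks \<in> compositions m q" "2 \<le> m" for ks m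
      using homogeneous_value_prod_list[of ks \<delta> q f v] compositions_less[OF that] that(1)
      by (simp add: compositions_def)
    \<comment> \<open>As \<open>m\<close> is at least 2, the coefficient ratio has degree 0 in
      \<open>\<delta>hat 0\<close>, and the whole degree \<open>q\<close> comes from the
      products.\<close>
    have summand: "homogeneous_value \<delta> q q
        (\<delta>hat m / \<delta>hat 1 * (\<Sum>ks\<in>compositions m q. prod_list (map f ks)))
        (\<delta> m / \<delta> 1 * (\<Sum>ks\<in>compositions m q. prod_list (map v ks)))" if "m \<in> {2..q}" for m
    proof -
      have "homogeneous_value \<delta> q 0 (\<delta>hat m / \<delta>hat 1) (\<delta> m / \<delta> 1)"
        using homogeneous_value_ratio[of m q \<delta>] that by (simp split: if_splits)
      moreover have "homogeneous_value \<delta> q q (\<Sum>ks\<in>compositions m q. prod_list (map f ks))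
          (\<Sum>ks\<in>compositions m q. prod_list (map v ks))"
        using that 3 \<open>\<delta> 1 \<noteq> 0\<close> by (intro homogeneous_value_sum prod) auto
      ultimately show ?thesis
        using homogeneous_value_mult by fastforce
    qed
    show ?thesis
      unfolding solves_recursionD(3)[OF f 3 less.prems] solves_recursionD(3)[OF v 3 less.prems]
      using 3 \<open>\<delta> 1 \<noteq> 0\<close> by (intro homogeneous_value_uminus homogeneous_value_sum summand) auto
  qed
qed

lemma homogeneous_value_evaluates_to:
  assumes "homogeneous_value \<delta> r s f v" "enat r \<le> p" "1 \<le> p" "\<delta> 1 \<noteq> 0"
  shows "f \<in> dratfuns_upto p" "evaluates_to p \<delta> f v"
proof -
  from assms(1) obtain P n where P: "P \<in> dpolys_upto (enat r)"
    "f = Fract P 1 / \<delta>hat 1 ^ n" "v = eval_dpoly \<delta> P / \<delta> 1 ^ n"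
    by (rule homogeneous_valueE)
  define Q where "Q = dvar 1 ^ n"
  have "P \<in> dpolys_upto p"
    using P(1) dpolys_upto_mono assms(2) by blast
  moreover have "Q \<in> dpolys_upto p"
    unfolding Q_def using assms(3) by (intro dpolys_upto_power dpolys_upto_dvar) (simp add: one_enat_def)
  moreover have "f = Fract P Q"
    unfolding P(2) Q_def \<delta>hat_power by simp
  moreover have "Q \<noteq> 0"
    unfolding Q_def by (intro power_not_zero dvar_nonzero)
  moreover have "eval_dpoly \<delta> Q = \<delta> 1 ^ n"
    unfolding Q_def by (simp only: eval_dpoly_power eval_dpoly_dvar)
  moreover have "\<delta> 1 ^ n \<noteq> 0"
    using assms(4) by simp
  ultimately show "f \<in> dratfuns_upto p" "evaluates_to p \<delta> f v"
    unfolding dratfuns_upto_def evaluates_to_def P(3) by fastforce+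
qed

section \<open>The relation as a recursion\<close>

lemma \<beta>star_eq:
  assumes "1 \<le> p" "\<And>k. 1 \<le> k \<Longrightarrow> enat k \<le> p + 1 \<Longrightarrow> \<beta> k = 2"
  shows "\<beta>star p \<beta> = 2"
proof -
  \<comment> \<open>The index 2 witnesses that the supremum of the constant 2 ranges over a nonempty
    set.\<close>
  have "enat 2 \<le> p + 1"
    using add_right_mono[OF assms(1), of 1] by (simp add: numeral_eq_enat one_add_one)
  then have "{m. 2 \<le> m \<and> enat m \<le> p + 1} \<noteq> {}" by blast
  moreover have "\<beta>star p \<beta> = (SUP m\<in>{m. 2 \<le> m \<and> enat m \<le> p + 1}. 2)"
    unfolding \<beta>star_def by (intro SUP_cong refl) (use assms(2) in auto)
  ultimately show ?thesis by simp
qed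

text \<open>With \<open>\<beta> m = 2\<close> the power \<open>n\<close> collects exactly the lists
  of sum \<open>n + 2\<close>. The guard \<open>- 2 \<le> n\<close> is explicit because
  \<open>nat\<close> would send smaller \<open>n\<close> to the sum 0.\<close>

lemma relation_coeff_eq:
  assumes "1 \<le> p" "\<beta> 0 = 1" "\<And>k. 1 \<le> k \<Longrightarrow> enat k \<le> p + 1 \<Longrightarrow> \<beta> k = 2" "a 0 = 0"
  shows "relation_coeff p \<beta> a n =
    (if - 2 \<le> n \<and> enat (nat (n + 2)) \<le> p
     then (\<delta>hat 0 when n = - 1) +
       (\<Sum>m=1..nat (n + 2). \<delta>hat m * (\<Sum>ks\<in>compositions m (nat (n + 2)). prod_list (map a ks)))
     else 0)"
proof -
  define q where "q = nat (n + 2)"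
  define C where "C \<longleftrightarrow> - 2 \<le> n \<and> enat q \<le> p"
  define T where "T m = (\<Sum>ks\<in>compositions m q. prod_list (map a ks))" for m
  have star: "\<beta>star p \<beta> = 2"
    using \<beta>star_eq assms(1,3) by blast
  have beta: "\<beta> m = 2" if "1 \<le> m" "enat m \<le> p" for m
    using that assms(3)[of m] by (meson le_iff_add order_trans)
  \<comment> \<open>Here the minimum in \<open>\<gamma>bound\<close> is 0, so the bound is
    \<open>p + 1\<close>, and lying strictly below it means being at most \<open>p\<close>, also for
    infinite \<open>p\<close>.\<close>
  have bound: "ereal (real s) < \<gamma>bound p \<beta> m \<longleftrightarrow> enat s \<le> p" if "1 \<le> m" "enat m \<le> p" for s m
    unfolding \<gamma>bound_def star beta[OF that] by (cases p) (auto simp: one_ereal_def)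
  \<comment> \<open>The term with \<open>\<delta>hat 0\<close> sits at \<open>n = - 1\<close>, that
    is \<open>q = 1\<close>, where \<open>C\<close> holds because \<open>1 \<le> p\<close>.\<close>
  have neg: "(\<delta>hat 0 when n = - \<beta> 0) = (if C then \<delta>hat 0 when n = - 1 else 0)"
    using assms(1,2) by (auto simp: when_def one_enat_def C_def q_def)
  have inner: "(\<Sum>ks | length ks = m \<and> ereal (real (sum_list ks)) < \<gamma>bound p \<beta> m \<and>
        int (sum_list ks) - \<beta> m = n. prod_list (map a ks)) = (if C then T m else 0)"
    if "1 \<le> m" "enat m \<le> p" for m
  proof -
    have "{ks. length ks = m \<and> ereal (real (sum_list ks)) < \<gamma>bound p \<beta> m \<and> int (sum_list ks) - \<beta> m = n} =
      (if C then {ks. length ks = m \<and> sum_list ks = q} else {})"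
      unfolding bound[OF that] beta[OF that] by (auto simp: C_def q_def)
    then show ?thesis
      using sum_lists_eq_sum_compositions[of a m q, OF assms(4)] by (simp add: T_def)
  qed
  let ?F = "\<lambda>m. (\<delta>hat m * (if C then T m else 0)) when (1 \<le> m \<and> enat m \<le> p)"
  have "(\<lambda>m. (\<delta>hat m * (\<Sum>ks | length ks = m \<and> ereal (real (sum_list ks)) < \<gamma>bound p \<beta> m \<and>
        int (sum_list ks) - \<beta> m = n. prod_list (map a ks))) when (1 \<le> m \<and> enat m \<le> p)) = ?F"
    by (intro ext when_cong refl) (simp only: inner)
  then have "relation_coeff p \<beta> a n = (\<delta>hat 0 when n = - \<beta> 0) + Sum_any ?F"
    unfolding relation_coeff_def by (simp only:)
  also have "Sum_any ?F = (\<Sum>m=1..q. ?F m)"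
  proof (rule Sum_any.expand_superset)
    \<comment> \<open>For \<open>m > q\<close> there are no compositions, so the sum over
      \<open>m\<close> has finite support even when \<open>p\<close> is infinite.\<close>
    have "?F m = 0" if "m \<notin> {1..q}" for m
      using that compositions_eq_empty[of q m] by (cases "m = 0") (simp_all add: T_def)
    then show "{m. ?F m \<noteq> 0} \<subseteq> {1..q}" by blast
  qed simp
  also have "\<dots> = (if C then (\<Sum>m=1..q. \<delta>hat m * T m) else 0)"
  proof (cases C)
    case True
    have "?F m = \<delta>hat m * T m" if "m \<in> {1..q}" for m
    proof -
      have "enat m \<le> enat q" using that by simp
      with True have "enat m \<le> p" unfolding C_def by (meson order_trans)
      with that True show ?thesis by simp
    qed
    with True show ?thesis by simp
  qed simp
  finally show ?thesis
    unfolding neg T_def C_def q_def by simp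
qed

lemma compositions_1: "1 \<le> q \<Longrightarrow> compositions (Suc 0) q = {[q]}"
  by (auto simp: compositions_def length_Suc_conv)

lemma relation_iff_recursion:
  assumes "1 \<le> p" "\<beta> 0 = 1" "\<And>k. 1 \<le> k \<Longrightarrow> enat k \<le> p + 1 \<Longrightarrow> \<beta> k = 2" "a 0 = 0"
  shows "(\<forall>n. relation_coeff p \<beta> a n = 0) \<longleftrightarrow> solves_recursion p \<delta>hat a"
proof -
  note coeff = relation_coeff_eq[of p \<beta> a, OF assms]
  define R where "R q = (\<Sum>m=2..q. \<delta>hat m * (\<Sum>ks\<in>compositions m q. prod_list (map a ks)))" for q
  have solve: "x * c + y = 0 \<longleftrightarrow> c = - (y / x)" if "x \<noteq> 0" for x c y :: dratfun
  proof -
    have "x * c + y = 0 \<longleftrightarrow> c * x = - y"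
      by (simp add: eq_neg_iff_add_eq_0 mult.commute)
    then show ?thesis
      by (simp only: minus_divide_left nonzero_eq_divide_eq[OF that])
  qed
  have coeff1: "relation_coeff p \<beta> a (- 1) = \<delta>hat 1 * a 1 + \<delta>hat 0"
    using assms(1) coeff[of "- 1"] by (simp add: compositions_1 one_enat_def add.commute)
  have coeff2: "relation_coeff p \<beta> a (int q - 2) = \<delta>hat 1 * a q + R q" if "2 \<le> q" "enat q \<le> p" for q
  proof -
    \<comment> \<open>Splitting off \<open>m = 1\<close>, whose only composition is
      \<open>[q]\<close>, isolates the new unknown \<open>a q\<close>; \<open>R q\<close> involves
      earlier terms only.\<close>
    have "{1..q} = insert 1 {2..q}" using that(1) by auto
    with that show ?thesis by (simp add: coeff compositions_1 R_def when_def)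
  qed
  \<comment> \<open>The remaining coefficients vanish by themselves: at \<open>n = - 2\<close> the
    sum over \<open>m\<close> is empty, and below that or for \<open>n + 2\<close> beyond
    \<open>p\<close> the guard fails.\<close>
  have "(\<forall>n. relation_coeff p \<beta> a n = 0) \<longleftrightarrow>
      relation_coeff p \<beta> a (- 1) = 0 \<and> (\<forall>q. 2 \<le> q \<and> enat q \<le> p \<longrightarrow> relation_coeff p \<beta> a (int q - 2) = 0)"
    (is "_ \<longleftrightarrow> ?rhs")
  proof (intro iffI allI)
    fix n :: int assume *: ?rhs
    consider "n < - 2" | "n = - 2" | "n = - 1" | "0 \<le> n" by linarith
    then show "relation_coeff p \<beta> a n = 0"
    proof cases
      case 4
      then have "2 \<le> nat (n + 2)" "int (nat (n + 2)) - 2 = n" by linarith+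
      with * show ?thesis
        by (cases "enat (nat (n + 2)) \<le> p") (metis, simp add: coeff)
    qed (use * in \<open>simp_all add: coeff\<close>)
  qed blast
  also have "\<dots> \<longleftrightarrow> a 1 = - (\<delta>hat 0 / \<delta>hat 1) \<and>
      (\<forall>q. 2 \<le> q \<and> enat q \<le> p \<longrightarrow> a q = - (R q / \<delta>hat 1))"
    unfolding coeff1 solve[OF \<delta>hat_nonzero] using coeff2 solve[OF \<delta>hat_nonzero] by auto
  also have "\<dots> \<longleftrightarrow> solves_recursion p \<delta>hat a"
    using assms(4) by (simp add: solves_recursion_def R_def sum_divide_distrib)
  finally show ?thesis .
qed

theorem lemma7:
  fixes p :: enat and \<beta> :: "nat \<Rightarrow> int" and \<delta> :: "nat \<Rightarrow> real"
  assumes "1 \<le> p"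
    and "\<beta> 0 = 1"
    and "\<And>k. 1 \<le> k \<Longrightarrow> enat k \<le> p + 1 \<Longrightarrow> \<beta> k = 2"
    and "\<delta> 1 \<noteq> 0"
  shows
    "(\<forall>\<alpha> \<alpha>hat. related_with \<beta> p \<delta> \<alpha> \<alpha>hat \<longleftrightarrow>
        lifts p \<delta> \<alpha> \<alpha>hat \<and>
        \<alpha>hat 1 = - \<delta>hat 0 / \<delta>hat 1 \<and>
        (\<forall>q. 2 \<le> q \<and> enat q \<le> p \<longrightarrow>
           \<alpha>hat q = - (\<Sum>m=2..q. \<delta>hat m / \<delta>hat 1 *
                        (\<Sum>ks | length ks = m \<and> sum_list ks = q. prod_list (map \<alpha>hat ks))))) \<and>
     (\<exists>!\<alpha>. \<alpha> \<in> extensional {k. enat k \<le> p} \<and> related \<beta> p \<delta> \<alpha>) \<and>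
     (\<forall>\<alpha> \<alpha>hat. related_with \<beta> p \<delta> \<alpha> \<alpha>hat \<longrightarrow>
        (\<forall>q. enat q \<le> p \<longrightarrow>
           (\<exists>P n. P \<in> dpolys_upto (enat q) \<and> \<alpha>hat q = Fract P 1 / \<delta>hat 1 ^ n \<and>
              (\<forall>t\<in>Poly_Mapping.keys P. Poly_Mapping.lookup t 0 = q) \<and>
              (1 \<le> q \<longrightarrow> P \<noteq> 0))))"
proof -
  have *: "related_with \<beta> p \<delta> \<alpha> \<alpha>hat \<longleftrightarrow> lifts p \<delta> \<alpha> \<alpha>hat \<and> solves_recursion p \<delta>hat \<alpha>hat" for \<alpha> \<alpha>hat
    using relation_iff_recursion[of p \<beta> \<alpha>hat, OF assms(1-3)]
    unfolding related_with_def lifts_def by blast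
  show ?thesis
  proof (intro conjI allI impI)
    fix \<alpha> \<alpha>hat
    show "related_with \<beta> p \<delta> \<alpha> \<alpha>hat \<longleftrightarrow>
        lifts p \<delta> \<alpha> \<alpha>hat \<and>
        \<alpha>hat 1 = - \<delta>hat 0 / \<delta>hat 1 \<and>
        (\<forall>q. 2 \<le> q \<and> enat q \<le> p \<longrightarrow>
           \<alpha>hat q = - (\<Sum>m=2..q. \<delta>hat m / \<delta>hat 1 *
                        (\<Sum>ks | length ks = m \<and> sum_list ks = q. prod_list (map \<alpha>hat ks))))"
    \<comment> \<open>The sums over all lists and over compositions agree only if
      \<open>\<alpha>hat 0 = 0\<close>; otherwise \<open>lifts\<close> fails and both sides are
      false.\<close>
    proof (cases "\<alpha>hat 0 = 0")
      case True
      then show ?thesis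
        unfolding * solves_recursion_def sum_lists_eq_sum_compositions[of \<alpha>hat, OF True] by blast
    next
      case False
      then show ?thesis
        unfolding * lifts_def by blast
    qed
  next
    obtain f where f: "solves_recursion p \<delta>hat f"
      using recursion_exists by blast
    obtain v where v: "solves_recursion p \<delta> v"
      using recursion_exists by blast
    \<comment> \<open>The real solution \<open>v\<close> is the evaluation of the formal solution
      \<open>f\<close>; restricting it fixes the values at indices beyond \<open>p\<close>.\<close>
    have "lifts p \<delta> (restrict v {k. enat k \<le> p}) f"
      unfolding lifts_def
      using homogeneous_value_evaluates_to[OF recursion_homogeneous_value[OF f v assms(4)] _ assms(1,4)]
        solves_recursionD(1)[OF f] by simp
    then have "related \<beta> p \<delta> (restrict v {k. enat k \<le> p})"
      unfolding related_def * using f by blast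
    moreover have "\<alpha> = \<alpha>'" if ext: "\<alpha> \<in> extensional {k. enat k \<le> p}" "\<alpha>' \<in> extensional {k. enat k \<le> p}"
      and rel: "related \<beta> p \<delta> \<alpha>" "related \<beta> p \<delta> \<alpha>'" for \<alpha> \<alpha>'
    proof (rule extensionalityI[OF ext])
      fix k assume "k \<in> {k. enat k \<le> p}"
      then have k: "enat k \<le> p" by simp
      obtain g where g: "lifts p \<delta> \<alpha> g" "solves_recursion p \<delta>hat g"
        using rel(1) unfolding related_def * by blast
      obtain h where h: "lifts p \<delta> \<alpha>' h" "solves_recursion p \<delta>hat h"
        using rel(2) unfolding related_def * by blast
      have "evaluates_to p \<delta> (g k) (\<alpha> k)" "evaluates_to p \<delta> (h k) (\<alpha>' k)"
        using g(1) h(1) k unfolding lifts_def by blast+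
      \<comment> \<open>The formal lifts coincide by the recursion, and a rational function has at
        most one value at \<open>\<delta>\<close>.\<close>
      moreover have "g k = h k"
        by (rule recursion_unique[OF g(2) h(2) k])
      ultimately show "\<alpha> k = \<alpha>' k"
        using evaluates_to_unique by metis
    qed
    ultimately show "\<exists>!\<alpha>. \<alpha> \<in> extensional {k. enat k \<le> p} \<and> related \<beta> p \<delta> \<alpha>"
      using restrict_extensional by blast
  next
    fix \<alpha> \<alpha>hat q
    assume rel: "related_with \<beta> p \<delta> \<alpha> \<alpha>hat" and q: "enat q \<le> p"
    \<comment> \<open>Since \<open>\<alpha>hat\<close> solves a recursion that does not mention
      \<open>\<delta>\<close>, its shape may be read off at any point with \<open>d 1\<close>
      nonzero. At this one the value is positive for \<open>1 \<le> q\<close>, so the numerator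
      \<open>P\<close> cannot be 0.\<close>
    define d where "d = (\<lambda>m :: nat. if m = 1 then 1 else - 1 :: real)"
    obtain v where v: "solves_recursion p d v"
      using recursion_exists by blast
    have "solves_recursion p \<delta>hat \<alpha>hat"
      using rel unfolding * by blast
    then have "homogeneous_value d q q (\<alpha>hat q) (v q)"
      by (rule recursion_homogeneous_value[OF _ v _ q]) (simp add: d_def)
    then obtain P n where P: "P \<in> dpolys_upto (enat q)" "homogeneous0 q P"
        "\<alpha>hat q = Fract P 1 / \<delta>hat 1 ^ n" "v q = eval_dpoly d P / d 1 ^ n"
      by (rule homogeneous_valueE)
    have "P \<noteq> 0" if "1 \<le> q"
      using recursion_pos[OF v[unfolded d_def] that q] P(4) by (auto simp: eval_dpoly_0)
    with P show "\<exists>P n. P \<in> dpolys_upto (enat q) \<and> \<alpha>hat q = Fract P 1 / \<delta>hat 1 ^ n \<and>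
        (\<forall>t\<in>Poly_Mapping.keys P. Poly_Mapping.lookup t 0 = q) \<and> (1 \<le> q \<longrightarrow> P \<noteq> 0)"
      unfolding homogeneous0_def by blast
  qed
qed

end
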